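(* Let $v_1,\dots,v_n\in\mathbb R^n$ be vectors in the unit ball. Then for every $\epsilon>0$ there exists a subset $U\subseteq\{v_1,\dots,v_n\}$ with $|U|\le 1/\epsilon$ such that $$\mathbb E_{i,j\in[n]}\|w_i\|\,\|w_j\|\,\langle\bar w_i,\bar w_j\rangle^2\le\epsilon,$$ where $w_i$ is the orthogonal projection of $v_i$ onto the orthogonal complement of the span of $U$.
   Context: $\bar w=w/\|w\|$ denotes the unit vector in the direction of $w$; a summand with $w_i=0$ or $w_j=0$ is taken to be $0$. $\mathbb E_{i,j\in[n]}$ denotes the average over independent uniform $i,j\in[n]$. *)

theory Defs
  imports "HOL-Analysis.Analysis"
begin

text \<open>Orthogonal projection onto a linear subspace \<open>S\<close>: the point \<open>y\<close> of \<open>S\<close>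
  with \<open>x - y\<close> orthogonal to \<open>S\<close>. The description is only meaningful when \<open>S\<close> is a subspace;
  \<open>orth_proj_works\<close> and \<open>orth_proj_unique\<close> show that it is then well defined.\<close>

definition orth_proj :: "'a::euclidean_space set \<Rightarrow> 'a \<Rightarrow> 'a" where
  "orth_proj S x = (THE y. y \<in> S \<and> x - y \<in> orthogonal_comp S)"

lemma ex1_orth_proj:
  fixes S :: "'a::euclidean_space set"
  assumes "subspace S"
  shows "\<exists>!y. y \<in> S \<and> x - y \<in> orthogonal_comp S"
proof (rule ex_ex1I)
  obtain y z where "y \<in> span S" "\<And>w. w \<in> span S \<Longrightarrow> orthogonal z w" "x = y + z"
    using orthogonal_subspace_decomp_exists by blast
  then show "\<exists>y. y \<in> S \<and> x - y \<in> orthogonal_comp S"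
    using assms by (auto simp: orthogonal_comp_def orthogonal_commute span_eq_iff[THEN iffD2]
      intro!: exI[of _ y])
next
  fix y z
  assume y: "y \<in> S \<and> x - y \<in> orthogonal_comp S" and z: "z \<in> S \<and> x - z \<in> orthogonal_comp S"
  have "y - z \<in> S"
    using y z assms by (simp add: subspace_diff)
  moreover have "(x - z) - (x - y) \<in> orthogonal_comp S"
    using y z subspace_orthogonal_comp subspace_diff by blast
  ultimately have "orthogonal (y - z) (y - z)"
    by (simp add: orthogonal_comp_def)
  then show "y = z"
    by (simp add: orthogonal_self)
qed

lemma orth_proj_works:
  assumes "subspace S"
  shows "orth_proj S x \<in> S" "x - orth_proj S x \<in> orthogonal_comp S"
  using theI'[OF ex1_orth_proj[OF assms, of x]] by (auto simp: orth_proj_def)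

lemma orth_proj_unique:
  assumes "subspace S" "y \<in> S" "x - y \<in> orthogonal_comp S"
  shows "orth_proj S x = y"
  using ex1_orth_proj[OF assms(1), of x] orth_proj_works[OF assms(1), of x] assms(2,3) by blast

end

theory Submission
  imports Defs
begin

text \<open>Choose \<open>U\<close> minimising the mean of \<open>\<parallel>w\<^sub>i\<parallel>\<^sup>2\<close> plus \<open>\<epsilon> \<cdot> card U\<close>. Comparison with \<open>U = {}\<close>
  gives the cardinality bound. Adding \<open>v\<^sub>j\<close> to \<open>U\<close> lowers \<open>\<parallel>w\<^sub>i\<parallel>\<^sup>2\<close> by
  \<open>\<parallel>w\<^sub>i\<parallel>\<^sup>2\<langle>sgn w\<^sub>i, sgn w\<^sub>j\<rangle>\<^sup>2\<close>, so minimality bounds the mean over \<open>i\<close> of these decrements by \<open>\<epsilon>\<close>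
  for every \<open>j\<close>. Averaging over \<open>j\<close> and using \<open>2ab \<le> a\<^sup>2 + b\<^sup>2\<close> gives the claim.\<close>

lemma mem_orthogonal_comp_span_iff:
  "x \<in> orthogonal_comp (span U) \<longleftrightarrow> (\<forall>u\<in>U. orthogonal u x)"
  for x :: "'a::euclidean_space"
  unfolding orthogonal_comp_def
  by (auto intro: span_base) (metis orthogonal_commute orthogonal_to_span)

lemma orth_proj_orthogonal_comp_span_works:
  fixes x :: "'a::euclidean_space"
  shows "orth_proj (orthogonal_comp (span U)) x \<in> orthogonal_comp (span U)"
    and "x - orth_proj (orthogonal_comp (span U)) x \<in> span U"
  using orth_proj_works[OF subspace_orthogonal_comp[of "span U"], of x]
  by (simp_all add: orthogonal_comp_self)

text \<open>One Gram-Schmidt step: \<open>p u\<close> is orthogonal to \<open>span U\<close>, and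
  enlarging \<open>U\<close> by \<open>u\<close> enlarges the span by exactly the line through
  \<open>p u\<close>, so only the component along that line is lost. If \<open>u\<close> already
  lies in \<open>span U\<close>, then \<open>p u = 0\<close> and \<open>sgn 0 = 0\<close> makes the
  correction vanish.\<close>

lemma orth_proj_orthogonal_comp_span_insert:
  fixes U :: "'a::euclidean_space set"
  defines "p \<equiv> orth_proj (orthogonal_comp (span U))"
  shows "orth_proj (orthogonal_comp (span (insert u U))) x
    = p x - (p x \<bullet> sgn (p u)) *\<^sub>R sgn (p u)"
proof (rule orth_proj_unique[OF subspace_orthogonal_comp])
  let ?e = "sgn (p u)"
  let ?y = "p x - (p x \<bullet> ?e) *\<^sub>R ?e"
  have mem: "p z \<in> orthogonal_comp (span U)" and diff: "z - p z \<in> span U" for z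
    unfolding p_def by (fact orth_proj_orthogonal_comp_span_works)+
  have y: "?y \<in> orthogonal_comp (span U)"
    using mem by (auto simp: sgn_div_norm
      intro!: subspace_diff subspace_scale subspace_orthogonal_comp)
  \<comment> \<open>Orthogonality to \<open>u\<close> is checked on its two parts:
    \<open>u - p u\<close> lies in \<open>span U\<close>, and \<open>p u\<close> is a multiple of
    \<open>?e\<close>, whose component has been removed from \<open>p x\<close>.\<close>
  have "(u - p u) \<bullet> ?y = 0"
    using y diff[of u] by (auto simp: orthogonal_comp_def orthogonal_def)
  moreover have "p u \<bullet> ?y = 0"
  proof -
    have "p u = norm (p u) *\<^sub>R ?e"
      by (cases "p u = 0") (auto simp: sgn_div_norm)
    moreover have "?e \<bullet> ?y = 0"
      by (cases "p u = 0") (auto simp: inner_diff_right inner_commute dot_square_norm norm_sgn)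
    ultimately show ?thesis
      by (metis inner_scaleR_left mult_zero_right)
  qed
  ultimately have "orthogonal u ?y"
    by (simp add: orthogonal_def inner_diff_left)
  then show "?y \<in> orthogonal_comp (span (insert u U))"
    using y by (simp add: mem_orthogonal_comp_span_iff)
  \<comment> \<open>It remains to place \<open>x - ?y\<close> in the double complement, which is the
    span itself. Writing \<open>p u\<close> as \<open>u - (u - p u)\<close> shows that
    \<open>?e\<close> belongs to it.\<close>
  have sub: "span U \<subseteq> span (insert u U)"
    by (intro span_mono) auto
  have "u - (u - p u) \<in> span (insert u U)"
    using diff[of u] sub by (blast intro: span_diff span_base)
  then have "?e \<in> span (insert u U)"
    by (simp add: sgn_div_norm span_scale)
  then have "(x - p x) + (p x \<bullet> ?e) *\<^sub>R ?e \<in> span (insert u U)"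
    using diff[of x] sub by (intro span_add span_scale) auto
  then show "x - ?y \<in> orthogonal_comp (orthogonal_comp (span (insert u U)))"
    by (simp add: orthogonal_comp_self algebra_simps)
qed

text \<open>Pythagoras for removing the component of \<open>a\<close> along a unit vector, with the
  loss rescaled through \<open>a = norm a *\<^sub>R sgn a\<close>. For \<open>b = 0\<close> nothing
  is removed and, as \<open>sgn 0 = 0\<close>, the loss is also zero.\<close>

lemma norm_diff_inner_sgn_sq:
  fixes a b :: "'a::real_inner"
  shows "(norm (a - (a \<bullet> sgn b) *\<^sub>R sgn b))\<^sup>2
    = (norm a)\<^sup>2 - (norm a)\<^sup>2 * (sgn a \<bullet> sgn b)\<^sup>2"
proof -
  have 1: "(a \<bullet> sgn b)\<^sup>2 = (norm a)\<^sup>2 * (sgn a \<bullet> sgn b)\<^sup>2"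
    by (cases "a = 0") (auto simp: sgn_div_norm power_mult_distrib power_inverse)
  have 2: "(a \<bullet> sgn b)\<^sup>2 * (sgn b \<bullet> sgn b) = (a \<bullet> sgn b)\<^sup>2"
    by (cases "b = 0") (auto simp: dot_square_norm norm_sgn)
  have "(norm (a - (a \<bullet> sgn b) *\<^sub>R sgn b))\<^sup>2
      = a \<bullet> a - 2 * (a \<bullet> sgn b)\<^sup>2 + (a \<bullet> sgn b)\<^sup>2 * (sgn b \<bullet> sgn b)"
    unfolding power2_norm_eq_inner
    by (simp add: inner_diff_left inner_diff_right inner_commute power2_eq_square algebra_simps)
  then show ?thesis
    unfolding 1[symmetric] 2 by (simp add: dot_square_norm)
qed

lemma norm_orth_proj_orthogonal_comp_le:
  "norm (orth_proj (orthogonal_comp S) x) \<le> norm x" for S :: "'a::euclidean_space set"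
proof -
  let ?p = "orth_proj (orthogonal_comp S) x"
  have "orthogonal ?p (x - ?p)"
    using orth_proj_works[OF subspace_orthogonal_comp[of S], of x]
    by (auto simp: orthogonal_comp_def)
  then have "(norm x)\<^sup>2 = (norm ?p)\<^sup>2 + (norm (x - ?p))\<^sup>2"
    using norm_add_Pythagorean by fastforce
  then show ?thesis
    by (simp add: power2_le_imp_le)
qed

text \<open>The weighted inequality 2ab \<le> a^2 + b^2 yields two square sums; symmetry of
  \<open>c\<close> makes them equal after exchanging the indices, which cancels the factor
  2.\<close>

lemma sum_mult_le_sum_square_symmetric:
  fixes a :: "'i \<Rightarrow> real"
  assumes "\<And>i j. c i j = c j i" "\<And>i j. 0 \<le> c i j"
  shows "(\<Sum>i\<in>A. \<Sum>j\<in>A. a i * a j * c i j) \<le> (\<Sum>j\<in>A. \<Sum>i\<in>A. (a i)\<^sup>2 * c i j)"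
proof -
  have "2 * (a i * a j * c i j) \<le> (a i)\<^sup>2 * c i j + (a j)\<^sup>2 * c i j" for i j
    using mult_right_mono[OF sum_squares_bound[of "a i" "a j"] assms(2)[of i j]]
    by (simp add: algebra_simps)
  then have "2 * (\<Sum>i\<in>A. \<Sum>j\<in>A. a i * a j * c i j)
      \<le> (\<Sum>i\<in>A. \<Sum>j\<in>A. (a i)\<^sup>2 * c i j) + (\<Sum>i\<in>A. \<Sum>j\<in>A. (a j)\<^sup>2 * c i j)"
    unfolding sum_distrib_left sum.distrib[symmetric] by (intro sum_mono)
  also have "(\<Sum>i\<in>A. \<Sum>j\<in>A. (a i)\<^sup>2 * c i j) = (\<Sum>j\<in>A. \<Sum>i\<in>A. (a i)\<^sup>2 * c i j)"
    by (rule sum.swap)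
  also have "(\<Sum>i\<in>A. \<Sum>j\<in>A. (a j)\<^sup>2 * c i j) = (\<Sum>j\<in>A. \<Sum>i\<in>A. (a i)\<^sup>2 * c i j)"
    by (intro sum.cong refl) (simp add: assms(1))
  finally show ?thesis
    by simp
qed

theorem theorem7p1:
  fixes v :: "'n::finite \<Rightarrow> real ^ 'n" and \<epsilon> :: real
  assumes "\<And>i. norm (v i) \<le> 1"
    and "\<epsilon> > 0"
  shows "\<exists>U. U \<subseteq> range v \<and> real (card U) \<le> 1 / \<epsilon> \<and>
    (let w = (\<lambda>i. orth_proj (orthogonal_comp (span U)) (v i)) in
      (\<Sum>i\<in>UNIV. \<Sum>j\<in>UNIV. norm (w i) * norm (w j) * (sgn (w i) \<bullet> sgn (w j))\<^sup>2)
        / (real CARD('n))\<^sup>2 \<le> \<epsilon>)"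
proof -
  define N where "N = real CARD('n)"
  have N: "N > 0"
    by (simp add: N_def)
  define w where "w U i = orth_proj (orthogonal_comp (span U)) (v i)" for U i
  \<comment> \<open>The objective is scaled by \<open>N\<close>, so sums replace means. A minimiser
    exists since \<open>range v\<close> has finitely many subsets.\<close>
  define \<Phi> where "\<Phi> U = (\<Sum>i\<in>UNIV. (norm (w U i))\<^sup>2) + N * \<epsilon> * real (card U)" for U
  obtain U where U: "U \<subseteq> range v" and min: "\<And>U'. U' \<subseteq> range v \<Longrightarrow> \<Phi> U \<le> \<Phi> U'"
    using ex_is_arg_min_if_finite[of "Pow (range v)" \<Phi>]
    by (auto simp: is_arg_min_linorder)
  define a c where "a i = norm (w U i)" and "c i j = (sgn (w U i) \<bullet> sgn (w U j))\<^sup>2" for i j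
  have "norm (w {} i) \<le> 1" for i
    unfolding w_def using norm_orth_proj_orthogonal_comp_le assms(1) by (rule order_trans)
  then have "(\<Sum>i\<in>UNIV. (norm (w {} i))\<^sup>2) \<le> (\<Sum>i\<in>(UNIV::'n set). 1)"
    by (intro sum_mono) (simp add: power_le_one)
  then have "\<Phi> {} \<le> N"
    by (simp add: \<Phi>_def N_def)
  moreover have "N * \<epsilon> * real (card U) \<le> \<Phi> U"
    by (simp add: \<Phi>_def sum_nonneg)
  ultimately have "N * (\<epsilon> * real (card U)) \<le> N * 1"
    using min[of "{}"] by simp
  then have card: "real (card U) \<le> 1 / \<epsilon>"
    using N assms(2) by (simp add: field_simps)
  have decr: "(\<Sum>i\<in>UNIV. (a i)\<^sup>2 * c i j) \<le> N * \<epsilon>" for j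
  proof -
    have "finite U"
      using finite_subset[OF U] by simp
    \<comment> \<open>Only an inequality, because \<open>v j\<close> may already belong to
      \<open>U\<close>; an upper bound on the new penalty is enough.\<close>
    then have "real (card (insert (v j) U)) \<le> real (card U) + 1"
      by (simp add: card_insert_if)
    then have "N * \<epsilon> * real (card (insert (v j) U)) \<le> N * \<epsilon> * (real (card U) + 1)"
      using N assms(2) by (intro mult_left_mono) auto
    moreover have "(norm (w (insert (v j) U) i))\<^sup>2 = (a i)\<^sup>2 - (a i)\<^sup>2 * c i j" for i
      unfolding w_def a_def c_def orth_proj_orthogonal_comp_span_insert
      by (rule norm_diff_inner_sgn_sq)
    ultimately have "\<Phi> (insert (v j) U) \<le> \<Phi> U - (\<Sum>i\<in>UNIV. (a i)\<^sup>2 * c i j) + N * \<epsilon>"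
      by (simp add: \<Phi>_def a_def[symmetric] sum_subtractf distrib_left)
    then show ?thesis
      using min[of "insert (v j) U"] U by simp
  qed
  have "(\<Sum>i\<in>UNIV. \<Sum>j\<in>UNIV. a i * a j * c i j) \<le> (\<Sum>j\<in>UNIV. \<Sum>i\<in>UNIV. (a i)\<^sup>2 * c i j)"
    by (rule sum_mult_le_sum_square_symmetric) (auto simp: c_def inner_commute)
  \<comment> \<open>Each of the \<open>N\<close> indices \<open>j\<close> contributes at most
    \<open>N * \<epsilon>\<close>, which matches the normalisation by
    \<open>N\<^sup>2\<close>.\<close>
  also have "\<dots> \<le> (\<Sum>j\<in>(UNIV::'n set). N * \<epsilon>)"
    by (intro sum_mono decr)
  also have "\<dots> = \<epsilon> * N\<^sup>2"
    by (simp add: N_def power2_eq_square)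
  finally have "(\<Sum>i\<in>UNIV. \<Sum>j\<in>UNIV. a i * a j * c i j) / N\<^sup>2 \<le> \<epsilon>"
    using N by (simp add: divide_le_eq)
  then show ?thesis
    using U card unfolding a_def c_def w_def N_def Let_def by blast
qed

end
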